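(* Let $a_1,b_1,c_1\in(0,1)$ and consider the channel from levels $\{A_0,A_1,A_2,A_3\}$ to outputs $\{s_0,s_1,s_2,s_3\}$ with transition matrix $p^E_{MLC}(y|v)$ whose rows (for $v=A_0,A_1,A_2,A_3$; columns $y=s_0,s_1,s_2,s_3$) are $$(a_1,1-a_1,0,0),\quad (0,b_1,1-b_1,0),\quad (0,0,c_1,1-c_1),\quad (0,0,0,1).$$ Then the rate regions satisfy the strict inclusions $$\mathscr R_G^{DS}\subset\mathscr R_G^{TIN},\qquad \mathscr R_{NO}^{TIN}\subset\mathscr R_G^{TIN},\qquad \mathscr R_G^{SC}\subset\mathscr R_{NO}^{SC},$$ and the sum rates satisfy $$r_{s(G)}^{TIN}>r_{s(G)}^{DS},\quad r_{s(G)}^{TIN}>r_{s(NO)}^{TIN},\quad r_{s(G)}^{TIN}>r_{s(EO)}^{TIN},\quad r_{s(G)}^{SC}=r_{s(NO)}^{SC}=r_{s(EO)}^{SC}.$$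
   Context: A labeling $\sigma=(w_0,w_1,w_2,w_3)$, an ordering of the four 2-bit strings, maps the input $(X_1,X_2)=w_i$ to level $A_i$. Labelings: Gray $\sigma_G=(11,10,00,01)$; Natural Order $\sigma_{NO}=(11,10,01,00)$; Even Odd $\sigma_{EO}=(11,00,01,10)$. Given a labeling $\sigma$, the inputs $X_1,X_2$ are independent and uniform on $\{0,1\}$, and $Y$ has conditional law $P(Y=y|X_1=x_1,X_2=x_2)=p^E_{MLC}(y\,|\,\sigma(x_1x_2))$. Mutual informations use logarithms to base 2. Subscripts $G,NO,EO$ indicate the labeling used. TIN: $\mathscr R^{TIN}=\{(R_1,R_2):0\le R_1\le I(X_1;Y),\ 0\le R_2\le I(X_2;Y)\}$, $r_s^{TIN}=I(X_1;Y)+I(X_2;Y)$. SC: $\mathscr R^{SC}=\{(R_1,R_2):R_1,R_2\ge0,\ R_1\le I(X_1;Y|X_2),\ R_2\le I(X_2;Y|X_1),\ R_1+R_2\le I(X_1,X_2;Y)\}$, $r_s^{SC}=I(X_1,X_2;Y)$. DS (default setting, used only with Gray labeling): let $Y_1$ be the function of $Y$ obtained by merging $s_0$ with $s_1$ and $s_2$ with $s_3$ (alphabet of size 2), and $Y_2$ the function of $Y$ obtained by merging $s_1$ with $s_2$ (alphabet $\{s_0,s_{1\cup2},s_3\}$). Then $\mathscr R^{DS}=\{(R_1,R_2):0\le R_1\le I(X_1;Y_1),\ 0\le R_2\le I(X_2;Y_2)\}$ and $r_s^{DS}=I(X_1;Y_1)+I(X_2;Y_2)$. *)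

theory Defs
  imports "HOL-Probability.Probability"
begin

datatype level = A0 | A1 | A2 | A3

datatype level_output = S0 | S1 | S2 | S3

text \<open>Bits are Booleans, with True for 1 and False for 0.  A labeling \<open>\<sigma> = (w\<^sub>0, w\<^sub>1, w\<^sub>2, w\<^sub>3)\<close> is
  represented by the bijection sending the level \<open>A\<^sub>i\<close> to the string \<open>w\<^sub>i\<close>; hence the level assigned
  to the input \<open>(x\<^sub>1, x\<^sub>2)\<close> is \<open>inv \<sigma> (x\<^sub>1, x\<^sub>2)\<close>.\<close>

type_synonym labeling = "level \<Rightarrow> bool \<times> bool"

fun labeling_G :: labeling where
  "labeling_G A0 = (True, True)"
| "labeling_G A1 = (True, False)"
| "labeling_G A2 = (False, False)"
| "labeling_G A3 = (False, True)"

fun labeling_NO :: labeling where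
  "labeling_NO A0 = (True, True)"
| "labeling_NO A1 = (True, False)"
| "labeling_NO A2 = (False, True)"
| "labeling_NO A3 = (False, False)"

fun labeling_EO :: labeling where
  "labeling_EO A0 = (True, True)"
| "labeling_EO A1 = (False, False)"
| "labeling_EO A2 = (False, True)"
| "labeling_EO A3 = (True, False)"

fun p_MLC_E :: "real \<Rightarrow> real \<Rightarrow> real \<Rightarrow> level \<Rightarrow> level_output \<Rightarrow> real" where
  "p_MLC_E a b c A0 y = (case y of S0 \<Rightarrow> a | S1 \<Rightarrow> 1 - a | S2 \<Rightarrow> 0 | S3 \<Rightarrow> 0)"
| "p_MLC_E a b c A1 y = (case y of S0 \<Rightarrow> 0 | S1 \<Rightarrow> b | S2 \<Rightarrow> 1 - b | S3 \<Rightarrow> 0)"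
| "p_MLC_E a b c A2 y = (case y of S0 \<Rightarrow> 0 | S1 \<Rightarrow> 0 | S2 \<Rightarrow> c | S3 \<Rightarrow> 1 - c)"
| "p_MLC_E a b c A3 y = (case y of S0 \<Rightarrow> 0 | S1 \<Rightarrow> 0 | S2 \<Rightarrow> 0 | S3 \<Rightarrow> 1)"

definition joint_pmf ::
    "(level \<Rightarrow> level_output \<Rightarrow> real) \<Rightarrow> labeling \<Rightarrow> (bool \<times> bool \<times> level_output) pmf" where
  "joint_pmf p \<sigma> =
     bind_pmf (pmf_of_set UNIV) (\<lambda>x1.
     bind_pmf (pmf_of_set UNIV) (\<lambda>x2.
     map_pmf (\<lambda>y. (x1, x2, y)) (embed_pmf (p (inv \<sigma> (x1, x2))))))"

definition X1 :: "bool \<times> bool \<times> level_output \<Rightarrow> bool" where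
  "X1 = (\<lambda>(x1, x2, y). x1)"

definition X2 :: "bool \<times> bool \<times> level_output \<Rightarrow> bool" where
  "X2 = (\<lambda>(x1, x2, y). x2)"

definition Y :: "bool \<times> bool \<times> level_output \<Rightarrow> level_output" where
  "Y = (\<lambda>(x1, x2, y). y)"

definition mutual_info :: "'a pmf \<Rightarrow> ('a \<Rightarrow> 'b) \<Rightarrow> ('a \<Rightarrow> 'c) \<Rightarrow> real" where
  "mutual_info P U V =
     prob_space.mutual_information (measure_pmf P) 2
       (count_space (range U)) (count_space (range V)) U V"

definition cond_mutual_info ::
    "'a pmf \<Rightarrow> ('a \<Rightarrow> 'b) \<Rightarrow> ('a \<Rightarrow> 'c) \<Rightarrow> ('a \<Rightarrow> 'd) \<Rightarrow> real" where
  "cond_mutual_info P U V W =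
     prob_space.conditional_mutual_information (measure_pmf P) 2
       (count_space (range U)) (count_space (range V)) (count_space (range W)) U V W"

definition region_TIN :: "(level \<Rightarrow> level_output \<Rightarrow> real) \<Rightarrow> labeling \<Rightarrow> (real \<times> real) set" where
  "region_TIN p \<sigma> = (let P = joint_pmf p \<sigma> in
     {(R1, R2). 0 \<le> R1 \<and> R1 \<le> mutual_info P X1 Y \<and> 0 \<le> R2 \<and> R2 \<le> mutual_info P X2 Y})"

definition sum_rate_TIN :: "(level \<Rightarrow> level_output \<Rightarrow> real) \<Rightarrow> labeling \<Rightarrow> real" where
  "sum_rate_TIN p \<sigma> = (let P = joint_pmf p \<sigma> in mutual_info P X1 Y + mutual_info P X2 Y)"

definition region_SC :: "(level \<Rightarrow> level_output \<Rightarrow> real) \<Rightarrow> labeling \<Rightarrow> (real \<times> real) set" where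
  "region_SC p \<sigma> = (let P = joint_pmf p \<sigma> in
     {(R1, R2). 0 \<le> R1 \<and> 0 \<le> R2 \<and>
        R1 \<le> cond_mutual_info P X1 Y X2 \<and>
        R2 \<le> cond_mutual_info P X2 Y X1 \<and>
        R1 + R2 \<le> mutual_info P (\<lambda>\<omega>. (X1 \<omega>, X2 \<omega>)) Y})"

definition sum_rate_SC :: "(level \<Rightarrow> level_output \<Rightarrow> real) \<Rightarrow> labeling \<Rightarrow> real" where
  "sum_rate_SC p \<sigma> = mutual_info (joint_pmf p \<sigma>) (\<lambda>\<omega>. (X1 \<omega>, X2 \<omega>)) Y"

datatype merged_output1 = S0u1 | S2u3

fun merge1 :: "level_output \<Rightarrow> merged_output1" where
  "merge1 S0 = S0u1"
| "merge1 S1 = S0u1"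
| "merge1 S2 = S2u3"
| "merge1 S3 = S2u3"

datatype merged_output2 = T0 | T1u2 | T3

fun merge2 :: "level_output \<Rightarrow> merged_output2" where
  "merge2 S0 = T0"
| "merge2 S1 = T1u2"
| "merge2 S2 = T1u2"
| "merge2 S3 = T3"

definition Y1 :: "bool \<times> bool \<times> level_output \<Rightarrow> merged_output1" where
  "Y1 = merge1 \<circ> Y"

definition Y2 :: "bool \<times> bool \<times> level_output \<Rightarrow> merged_output2" where
  "Y2 = merge2 \<circ> Y"

definition region_DS :: "(level \<Rightarrow> level_output \<Rightarrow> real) \<Rightarrow> labeling \<Rightarrow> (real \<times> real) set" where
  "region_DS p \<sigma> = (let P = joint_pmf p \<sigma> in
     {(R1, R2). 0 \<le> R1 \<and> R1 \<le> mutual_info P X1 Y1 \<and> 0 \<le> R2 \<and> R2 \<le> mutual_info P X2 Y2})"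

definition sum_rate_DS :: "(level \<Rightarrow> level_output \<Rightarrow> real) \<Rightarrow> labeling \<Rightarrow> real" where
  "sum_rate_DS p \<sigma> = (let P = joint_pmf p \<sigma> in mutual_info P X1 Y1 + mutual_info P X2 Y2)"

text \<open>The labelings are bijections and the rows of the transition matrix are probability vectors, so
  neither \<^const>\<open>inv\<close> nor \<^const>\<open>embed_pmf\<close> is used outside its domain in \<^const>\<open>joint_pmf\<close>.\<close>

lemma UNIV_level: "UNIV = {A0, A1, A2, A3}"
  using level.exhaust by auto

lemma UNIV_level_output: "UNIV = {S0, S1, S2, S3}"
  using level_output.exhaust by auto

lemma bij_labeling_G: "bij labeling_G"
proof (rule bijI)
  show "inj labeling_G"
    unfolding inj_def UNIV_level by simp
  show "surj labeling_G"
    unfolding UNIV_level by (auto simp: UNIV_bool UNIV_Times_UNIV[symmetric] simp del: UNIV_Times_UNIV)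
qed

lemma bij_labeling_NO: "bij labeling_NO"
proof (rule bijI)
  show "inj labeling_NO"
    unfolding inj_def UNIV_level by simp
  show "surj labeling_NO"
    unfolding UNIV_level by (auto simp: UNIV_bool UNIV_Times_UNIV[symmetric] simp del: UNIV_Times_UNIV)
qed

lemma bij_labeling_EO: "bij labeling_EO"
proof (rule bijI)
  show "inj labeling_EO"
    unfolding inj_def UNIV_level by simp
  show "surj labeling_EO"
    unfolding UNIV_level by (auto simp: UNIV_bool UNIV_Times_UNIV[symmetric] simp del: UNIV_Times_UNIV)
qed

lemma pmf_embed_p_MLC_E:
  assumes "a \<in> {0..1}" "b \<in> {0..1}" "c \<in> {0..1}"
  shows "pmf (embed_pmf (p_MLC_E a b c v)) y = p_MLC_E a b c v y"
proof (rule pmf_embed_pmf)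
  show nn: "0 \<le> p_MLC_E a b c v z" for z
    using assms by (cases v; cases z) auto
  have "(\<integral>\<^sup>+ z. ennreal (p_MLC_E a b c v z) \<partial>count_space UNIV) =
      (\<Sum>z\<in>UNIV. ennreal (p_MLC_E a b c v z))"
    by (rule nn_integral_count_space_finite) (simp add: UNIV_level_output)
  also have "\<dots> = ennreal (\<Sum>z\<in>UNIV. p_MLC_E a b c v z)"
    by (rule sum_ennreal) (use nn in auto)
  also have "(\<Sum>z\<in>UNIV. p_MLC_E a b c v z) = 1"
    by (cases v) (simp_all add: UNIV_level_output)
  finally show "(\<integral>\<^sup>+ z. ennreal (p_MLC_E a b c v z) \<partial>count_space UNIV) = 1"
    by simp
qed

lemma pmf_joint_pmf:
  "pmf (joint_pmf p \<sigma>) (x1, x2, y) = 1 / 4 * pmf (embed_pmf (p (inv \<sigma> (x1, x2)))) y"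
proof -
  have *: "pmf (map_pmf (\<lambda>y. (u, v, y)) q) (x1, x2, y) = (if u = x1 \<and> v = x2 then pmf q y else 0)"
    for u v :: bool and q :: "level_output pmf"
  proof (cases "u = x1 \<and> v = x2")
    case True
    then show ?thesis
      using pmf_map_inj'[of "\<lambda>y. (u, v, y)" q y] by (auto simp: inj_def)
  next
    case False
    then show ?thesis
      by (auto intro!: pmf_map_outside)
  qed
  show ?thesis
    unfolding joint_pmf_def
    by (simp add: pmf_bind integral_pmf_of_set * UNIV_bool)
qed

end

theory Submission
  imports Defs
begin

text \<open>The input \<open>(X\<^sub>1, X\<^sub>2)\<close> is a bijective relabelling of a uniform level, so \<open>I(X\<^sub>1, X\<^sub>2; Y)\<close> does not
  depend on the labeling, and each of \<open>X\<^sub>1\<close>, \<open>X\<^sub>2\<close> is a balanced two-colouring of the levels. There are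
  three such colourings up to complement, \<open>01|23\<close>, \<open>03|12\<close> and \<open>02|13\<close>, and the labelings G, NO, EO use
  the first two, the first and third, and the last two of them. An output is caused by at most two
  adjacent levels, and it contributes to the conditional entropy of a colouring iff these levels have
  different colours. The colouring \<open>02|13\<close> separates all adjacent levels, whereas the other two do not;
  it therefore has strictly the smallest mutual information with \<open>Y\<close>. Merging outputs enlarges one of
  the two masses competing for an output, which strictly increases the conditional entropy.\<close>

section \<open>Finiteness of the alphabets\<close>

instance level :: finite
  by standard (simp add: UNIV_level)

instance level_output :: finite
  by standard (simp add: UNIV_level_output)

lemma UNIV_merged_output1: "UNIV = {S0u1, S2u3}"
  using merged_output1.exhaust by auto

lemma UNIV_merged_output2: "UNIV = {T0, T1u2, T3}"
  using merged_output2.exhaust by auto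

instance merged_output1 :: finite
  by standard (simp add: UNIV_merged_output1)

instance merged_output2 :: finite
  by standard (simp add: UNIV_merged_output2)

section \<open>Entropy of finite distributions\<close>

text \<open>Shannon entropy in bits. As an expectation it pulls back along \<open>map_pmf\<close>,
  so the entropies of several variables become integrals over one common space.\<close>

definition ent :: "'a::finite pmf \<Rightarrow> real" where
  "ent q = - measure_pmf.expectation q (\<lambda>x. log 2 (pmf q x))"

lemma expectation_finite:
  fixes q :: "'a::finite pmf" and f :: "'a \<Rightarrow> real"
  shows "measure_pmf.expectation q f = (\<Sum>x\<in>UNIV. pmf q x * f x)"
  by (subst integral_measure_pmf[of UNIV]) auto

lemma ent_eq_sum: "ent q = - (\<Sum>x\<in>UNIV. pmf q x * log 2 (pmf q x))"
  by (simp add: ent_def expectation_finite)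

lemma ent_map_pmf_inj:
  assumes "inj f"
  shows "ent (map_pmf f q) = ent q"
  using assms by (simp add: ent_def pmf_map_inj')

lemma information_space_measure_pmf: "information_space (measure_pmf P) 2"
  by unfold_locales simp

lemma simple_distributed_pmf:
  fixes P :: "'a::finite pmf"
  shows "simple_distributed (measure_pmf P) U (pmf (map_pmf U P))"
  by (rule measure_pmf.simple_distributedI) (auto simp: simple_function_def pmf_map)

text \<open>Values outside \<open>range U\<close> have mass zero, so the sum may run over the whole
  type. This turns sums over ranges, the form of the standard formulas for simple distributions,
  into expectations under \<open>P\<close>.\<close>

lemma sum_range_pmf_map:
  fixes P :: "'a::finite pmf" and U :: "'a \<Rightarrow> 'b::finite" and h :: "'b \<Rightarrow> real"
  shows "(\<Sum>u\<in>range U. pmf (map_pmf U P) u * h u) = measure_pmf.expectation P (\<lambda>\<omega>. h (U \<omega>))"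
proof -
  have "(\<Sum>u\<in>range U. pmf (map_pmf U P) u * h u) = (\<Sum>u\<in>UNIV. pmf (map_pmf U P) u * h u)"
    by (rule sum.mono_neutral_left) (auto intro!: pmf_map_outside)
  also have "\<dots> = measure_pmf.expectation (map_pmf U P) h"
    by (simp add: expectation_finite)
  finally show ?thesis
    by simp
qed

lemma pmf_map_pos: "\<omega> \<in> set_pmf P \<Longrightarrow> 0 < pmf (map_pmf f P) (f \<omega>)"
  by (auto intro!: pmf_positive)

lemma mutual_info_eq_ent:
  fixes P :: "'a::finite pmf" and U :: "'a \<Rightarrow> 'b::finite" and V :: "'a \<Rightarrow> 'c::finite"
  shows "mutual_info P U V =
    ent (map_pmf U P) + ent (map_pmf V P) - ent (map_pmf (\<lambda>\<omega>. (U \<omega>, V \<omega>)) P)"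
proof -
  interpret information_space "measure_pmf P" 2
    by (rule information_space_measure_pmf)
  let ?UV = "\<lambda>\<omega>. (U \<omega>, V \<omega>)"
  define h where "h = (\<lambda>(u, v). log 2 (pmf (map_pmf ?UV P) (u, v) /
    (pmf (map_pmf U P) u * pmf (map_pmf V P) v)))"
  have "mutual_info P U V = (\<Sum>t\<in>range ?UV. pmf (map_pmf ?UV P) t * h t)"
    using mutual_information_simple_distributed[OF simple_distributed_pmf[of P U]
        simple_distributed_pmf[of P V] simple_distributed_pmf[of P ?UV]]
    by (simp add: mutual_info_def h_def case_prod_unfold)
  also have "\<dots> = measure_pmf.expectation P (\<lambda>\<omega>. h (?UV \<omega>))"
    by (rule sum_range_pmf_map)
  also have "\<dots> = measure_pmf.expectation P (\<lambda>\<omega>. log 2 (pmf (map_pmf ?UV P) (?UV \<omega>))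
      - log 2 (pmf (map_pmf U P) (U \<omega>)) - log 2 (pmf (map_pmf V P) (V \<omega>)))"
  \<comment> \<open>Only the support of \<open>P\<close> matters; there all the masses are positive
    and the logarithm of the quotient splits.\<close>
  proof (intro integral_cong_AE AE_pmfI)
    fix \<omega> assume \<omega>: "\<omega> \<in> set_pmf P"
    show "h (?UV \<omega>) = log 2 (pmf (map_pmf ?UV P) (?UV \<omega>))
        - log 2 (pmf (map_pmf U P) (U \<omega>)) - log 2 (pmf (map_pmf V P) (V \<omega>))"
      using pmf_map_pos[OF \<omega>, of ?UV] pmf_map_pos[OF \<omega>, of U] pmf_map_pos[OF \<omega>, of V]
      by (simp add: h_def log_divide_pos log_mult_pos)
  qed auto
  finally show ?thesis
    by (simp add: ent_def integrable_measure_pmf_finite)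
qed

lemma mutual_info_nonneg:
  fixes P :: "'a::finite pmf"
  shows "0 \<le> mutual_info P U V"
proof -
  interpret information_space "measure_pmf P" 2
    by (rule information_space_measure_pmf)
  show ?thesis
    using mutual_information_nonneg_simple[of U V]
    by (simp add: mutual_info_def simple_function_def)
qed

lemma cond_mutual_info_nonneg:
  fixes P :: "'a::finite pmf"
  shows "0 \<le> cond_mutual_info P U V W"
proof -
  interpret information_space "measure_pmf P" 2
    by (rule information_space_measure_pmf)
  show ?thesis
    using conditional_mutual_information_nonneg[of U V W]
    by (simp add: cond_mutual_info_def simple_function_def)
qed

lemma cond_mutual_info_eq_ent:
  fixes P :: "'a::finite pmf" and U :: "'a \<Rightarrow> 'b::finite" and V :: "'a \<Rightarrow> 'c::finite"
    and W :: "'a \<Rightarrow> 'd::finite"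
  shows "cond_mutual_info P U V W =
    ent (map_pmf (\<lambda>\<omega>. (U \<omega>, W \<omega>)) P) + ent (map_pmf (\<lambda>\<omega>. (V \<omega>, W \<omega>)) P)
    - ent (map_pmf (\<lambda>\<omega>. (U \<omega>, V \<omega>, W \<omega>)) P) - ent (map_pmf W P)"
proof -
  interpret information_space "measure_pmf P" 2
    by (rule information_space_measure_pmf)
  let ?UVW = "\<lambda>\<omega>. (U \<omega>, V \<omega>, W \<omega>)" and ?UW = "\<lambda>\<omega>. (U \<omega>, W \<omega>)" and ?VW = "\<lambda>\<omega>. (V \<omega>, W \<omega>)"
  define h where "h = (\<lambda>(u, v, w). log 2 (pmf (map_pmf ?UVW P) (u, v, w) /
    (pmf (map_pmf ?UW P) (u, w) * (pmf (map_pmf ?VW P) (v, w) / pmf (map_pmf W P) w))))"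
  have "cond_mutual_info P U V W = (\<Sum>t\<in>range ?UVW. pmf (map_pmf ?UVW P) t * h t)"
    using conditional_mutual_information_eq[OF simple_distributed_pmf[of P W]
        simple_distributed_pmf[of P ?VW] simple_distributed_pmf[of P ?UW]
        simple_distributed_pmf[of P ?UVW]]
    by (simp add: cond_mutual_info_def h_def case_prod_unfold)
  also have "\<dots> = measure_pmf.expectation P (\<lambda>\<omega>. h (?UVW \<omega>))"
    by (rule sum_range_pmf_map)
  also have "\<dots> = measure_pmf.expectation P (\<lambda>\<omega>. log 2 (pmf (map_pmf ?UVW P) (?UVW \<omega>))
      + log 2 (pmf (map_pmf W P) (W \<omega>)) - log 2 (pmf (map_pmf ?UW P) (?UW \<omega>))
      - log 2 (pmf (map_pmf ?VW P) (?VW \<omega>)))"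
  proof (intro integral_cong_AE AE_pmfI)
    fix \<omega> assume \<omega>: "\<omega> \<in> set_pmf P"
    show "h (?UVW \<omega>) = log 2 (pmf (map_pmf ?UVW P) (?UVW \<omega>))
        + log 2 (pmf (map_pmf W P) (W \<omega>)) - log 2 (pmf (map_pmf ?UW P) (?UW \<omega>))
        - log 2 (pmf (map_pmf ?VW P) (?VW \<omega>))"
      using pmf_map_pos[OF \<omega>, of ?UVW] pmf_map_pos[OF \<omega>, of ?UW] pmf_map_pos[OF \<omega>, of ?VW]
        pmf_map_pos[OF \<omega>, of W]
      by (simp add: h_def log_divide_pos log_mult_pos)
  qed auto
  finally show ?thesis
    by (simp add: ent_def integrable_measure_pmf_finite)
qed

text \<open>The chain rule. In entropies, both sides differ only by the order of tuple components,
  and entropy is invariant under injective renaming.\<close>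

lemma cond_mutual_info_chain:
  fixes P :: "'a::finite pmf" and U :: "'a \<Rightarrow> 'b::finite" and V :: "'a \<Rightarrow> 'c::finite"
    and W :: "'a \<Rightarrow> 'd::finite"
  shows "cond_mutual_info P U V W = mutual_info P (\<lambda>\<omega>. (U \<omega>, W \<omega>)) V - mutual_info P W V"
proof -
  have "ent (map_pmf (\<lambda>\<omega>. ((U \<omega>, W \<omega>), V \<omega>)) P) = ent (map_pmf (\<lambda>\<omega>. (U \<omega>, V \<omega>, W \<omega>)) P)"
    using ent_map_pmf_inj[of "\<lambda>(u, v, w). ((u, w), v)" "map_pmf (\<lambda>\<omega>. (U \<omega>, V \<omega>, W \<omega>)) P"]
    by (simp add: pmf.map_comp o_def inj_def)
  moreover have "ent (map_pmf (\<lambda>\<omega>. (V \<omega>, W \<omega>)) P) = ent (map_pmf (\<lambda>\<omega>. (W \<omega>, V \<omega>)) P)"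
    using ent_map_pmf_inj[of prod.swap "map_pmf (\<lambda>\<omega>. (V \<omega>, W \<omega>)) P"]
    by (simp add: pmf.map_comp o_def)
  ultimately show ?thesis
    by (simp add: cond_mutual_info_eq_ent mutual_info_eq_ent)
qed

lemma mutual_info_map_pmf:
  fixes Q :: "'a::finite pmf" and f :: "'a \<Rightarrow> 'b::finite"
    and U :: "'b \<Rightarrow> 'c::finite" and V :: "'b \<Rightarrow> 'd::finite"
  shows "mutual_info (map_pmf f Q) U V = mutual_info Q (\<lambda>x. U (f x)) (\<lambda>x. V (f x))"
  by (simp add: mutual_info_eq_ent pmf.map_comp o_def)

text \<open>Renaming the values of \<open>U\<close> injectively preserves both the entropy of
  \<open>U\<close> and the joint entropy. This later removes the labeling from the joint mutual
  information.\<close>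

lemma mutual_info_inj:
  fixes P :: "'a::finite pmf" and f :: "'b::finite \<Rightarrow> 'c::finite" and V :: "'a \<Rightarrow> 'd::finite"
  assumes "inj f"
  shows "mutual_info P (\<lambda>x. f (U x)) V = mutual_info P U V"
proof -
  have "ent (map_pmf (\<lambda>x. f (U x)) P) = ent (map_pmf U P)"
    using ent_map_pmf_inj[OF assms, of "map_pmf U P"] by (simp add: pmf.map_comp o_def)
  moreover have "inj (map_prod f id)"
    using assms by (simp add: prod.inj_map)
  then have "ent (map_pmf (\<lambda>x. (f (U x), V x)) P) = ent (map_pmf (\<lambda>x. (U x, V x)) P)"
    using ent_map_pmf_inj[of "map_prod f id" "map_pmf (\<lambda>x. (U x, V x)) P"]
    by (simp add: pmf.map_comp o_def)
  ultimately show ?thesis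
    by (simp add: mutual_info_eq_ent)
qed

section \<open>Equivocation of a binary variable\<close>

text \<open>Unnormalised binary entropy: \<open>s + t\<close> times the entropy of the split
  \<open>s : t\<close>. It is the contribution to the equivocation H(U|V) of a value of V reached
  with masses \<open>s\<close> and \<open>t\<close> from the two values of a bit U.\<close>

definition split_ent :: "real \<Rightarrow> real \<Rightarrow> real" where
  "split_ent s t = (s + t) * log 2 (s + t) - s * log 2 s - t * log 2 t"

lemma split_ent_0 [simp]: "split_ent 0 t = 0" "split_ent s 0 = 0"
  by (simp_all add: split_ent_def)

lemma split_ent_commute: "split_ent s t = split_ent t s"
  by (simp add: split_ent_def add.commute)

lemma split_ent_pos:
  assumes "0 < s" "0 < t"
  shows "0 < split_ent s t"
proof -
  have "0 < s * (log 2 (s + t) - log 2 s)" "0 < t * (log 2 (s + t) - log 2 t)"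
    using assms by (auto intro!: mult_pos_pos)
  then show ?thesis
    by (simp add: split_ent_def algebra_simps)
qed

text \<open>The derivative in the second argument is \<open>log 2 (s + x) - log 2 x\<close>, which
  is positive because \<open>s\<close> is; the constants \<open>1 / ln 2\<close> cancel.\<close>

lemma split_ent_strict_mono:
  assumes "0 < s" "0 < t" "t < t'"
  shows "split_ent s t < split_ent s t'"
proof (rule DERIV_pos_imp_increasing[OF assms(3)])
  fix x assume "t \<le> x" "x \<le> t'"
  then have x: "0 < x"
    using assms by simp
  have D: "((\<lambda>y. y * log 2 y) has_real_derivative log 2 y + 1 / ln 2) (at y)" if "0 < y" for y
    unfolding log_def using that by (auto intro!: derivative_eq_intros simp: field_simps)
  have "((\<lambda>x. (x + s) * log 2 (x + s)) has_real_derivative log 2 (x + s) + 1 / ln 2) (at x)"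
    using D[of "x + s"] x assms(1) by (simp add: DERIV_shift)
  from DERIV_diff[OF this D[OF x]]
  have "((\<lambda>x. (s + x) * log 2 (s + x) - x * log 2 x - s * log 2 s) has_real_derivative
      (log 2 (s + x) - log 2 x)) (at x)"
    \<comment> \<open>The summand \<open>s * log 2 s\<close> is constant in \<open>x\<close>, hence
      the derivative \<open>E = 0\<close>.\<close>
    by (auto intro!: DERIV_diff[where E = 0, simplified] simp: add.commute)
  then have "(split_ent s has_real_derivative (log 2 (s + x) - log 2 x)) (at x)"
    by (simp add: split_ent_def[abs_def] algebra_simps)
  moreover have "0 < log 2 (s + x) - log 2 x"
    using x assms by simp
  ultimately show "\<exists>y. (split_ent s has_real_derivative y) (at x) \<and> 0 < y"
    by blast
qed

text \<open>This is I(U;V) = H(U) - H(U|V): a fair bit has entropy 1, and H(U,V) - H(V) decomposes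
  value by value of V into \<open>split_ent\<close> terms.\<close>

lemma mutual_info_uniform_bool:
  fixes P :: "'a::finite pmf" and U :: "'a \<Rightarrow> bool" and V :: "'a \<Rightarrow> 'c::finite"
  assumes "map_pmf U P = pmf_of_set UNIV"
  defines "q \<equiv> pmf (map_pmf (\<lambda>x. (U x, V x)) P)"
  shows "mutual_info P U V = 1 - (\<Sum>v\<in>UNIV. split_ent (q (True, v)) (q (False, v)))"
proof -
  have V: "pmf (map_pmf V P) v = q (True, v) + q (False, v)" for v
  proof -
    define R where "R = map_pmf (\<lambda>x. (U x, V x)) P"
    have "map_pmf V P = map_pmf snd R"
      by (simp add: R_def pmf.map_comp o_def)
    moreover have "snd -` {v} = {(True, v), (False, v)}"
      by auto
    ultimately show ?thesis
      by (simp add: pmf_map[of snd] measure_measure_pmf_finite q_def flip: R_def)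
  qed
  have "ent (pmf_of_set (UNIV :: bool set)) = 1"
    by (simp add: ent_eq_sum UNIV_bool log_divide)
  moreover have "ent (map_pmf (\<lambda>x. (U x, V x)) P) =
      - (\<Sum>v\<in>UNIV. q (True, v) * log 2 (q (True, v)) + q (False, v) * log 2 (q (False, v)))"
  proof -
    have "ent (map_pmf (\<lambda>x. (U x, V x)) P) = - (\<Sum>b\<in>UNIV. \<Sum>v\<in>UNIV. q (b, v) * log 2 (q (b, v)))"
      by (simp add: ent_eq_sum q_def sum.cartesian_product)
    then show ?thesis
      by (simp add: UNIV_bool sum.distrib add.commute)
  qed
  ultimately show ?thesis
    unfolding mutual_info_eq_ent assms(1)
    by (simp add: ent_eq_sum V split_ent_def sum_subtractf sum.distrib)
qed

section \<open>The channel driven by a uniform level\<close>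

text \<open>A labeling-free counterpart of \<open>joint_pmf\<close>: one probability space on which
  all three labelings can be compared.\<close>

definition level_pmf :: "(level \<Rightarrow> level_output \<Rightarrow> real) \<Rightarrow> (level \<times> level_output) pmf" where
  "level_pmf p = bind_pmf (pmf_of_set UNIV) (\<lambda>v. map_pmf (Pair v) (embed_pmf (p v)))"

lemma map_fst_level_pmf: "map_pmf fst (level_pmf p) = pmf_of_set UNIV"
  by (simp add: level_pmf_def map_bind_pmf pmf.map_comp o_def bind_return_pmf')

lemma pmf_level_pmf: "pmf (level_pmf p) (v, y) = 1 / 4 * pmf (embed_pmf (p v)) y"
proof -
  have *: "pmf (map_pmf (Pair u) q) (v, y) = (if u = v then pmf q y else 0)"
    for u and q :: "level_output pmf"
    using pmf_map_inj'[of "Pair u" q y] by (auto simp: inj_def intro!: pmf_map_outside)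
  have "pmf (level_pmf p) (v, y) = (\<Sum>u\<in>UNIV. if u = v then pmf (embed_pmf (p u)) y else 0) / 4"
    by (simp add: level_pmf_def pmf_bind integral_pmf_of_set * UNIV_level)
  then show ?thesis
    by simp
qed

text \<open>A bijective labeling carries the uniform level to a uniform pair of bits. The map is
  injective, so point masses can be compared directly, and both carry the factor 1/4.\<close>

lemma joint_pmf_eq_level_pmf:
  assumes "bij \<sigma>"
  shows "joint_pmf p \<sigma> = map_pmf (\<lambda>(v, y). (fst (\<sigma> v), snd (\<sigma> v), y)) (level_pmf p)"
    (is "_ = map_pmf ?f _")
proof (rule pmf_eqI)
  fix \<omega> :: "bool \<times> bool \<times> level_output"
  obtain x1 x2 y where \<omega>: "\<omega> = (x1, x2, y)"
    by (cases \<omega>)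
  have inj: "inj ?f"
    using bij_is_inj[OF assms] by (auto simp: inj_def prod_eq_iff)
  have "?f (inv \<sigma> (x1, x2), y) = \<omega>"
    using assms by (simp add: \<omega> bij_is_surj surj_f_inv_f)
  then have "pmf (map_pmf ?f (level_pmf p)) \<omega> = pmf (level_pmf p) (inv \<sigma> (x1, x2), y)"
    using pmf_map_inj'[OF inj, of "level_pmf p" "(inv \<sigma> (x1, x2), y)"] by (simp only:)
  then show "pmf (joint_pmf p \<sigma>) \<omega> = pmf (map_pmf ?f (level_pmf p)) \<omega>"
    by (simp only: \<omega> pmf_joint_pmf pmf_level_pmf)
qed

text \<open>\<open>B\<close> is the colouring of the levels given by one input bit and
  \<open>m\<close> a processing of the output: the identity for TIN, a merging for DS.\<close>

definition color_info ::
    "(level \<Rightarrow> level_output \<Rightarrow> real) \<Rightarrow> (level_output \<Rightarrow> 'b) \<Rightarrow> (level \<Rightarrow> bool) \<Rightarrow> real" where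
  "color_info p m B = mutual_info (level_pmf p) (\<lambda>x. B (fst x)) (\<lambda>x. m (snd x))"

lemma mutual_info_joint_pmf:
  assumes "bij \<sigma>"
  shows "mutual_info (joint_pmf p \<sigma>) X1 Y = color_info p (\<lambda>y. y) (\<lambda>v. fst (\<sigma> v))"
    and "mutual_info (joint_pmf p \<sigma>) X2 Y = color_info p (\<lambda>y. y) (\<lambda>v. snd (\<sigma> v))"
    and "mutual_info (joint_pmf p \<sigma>) X1 Y1 = color_info p merge1 (\<lambda>v. fst (\<sigma> v))"
    and "mutual_info (joint_pmf p \<sigma>) X2 Y2 = color_info p merge2 (\<lambda>v. snd (\<sigma> v))"
  by (simp_all add: joint_pmf_eq_level_pmf[OF assms] mutual_info_map_pmf color_info_def
      X1_def X2_def Y1_def Y2_def Y_def case_prod_unfold)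

lemma sum_rate_SC_eq:
  assumes "bij \<sigma>"
  shows "sum_rate_SC p \<sigma> = mutual_info (level_pmf p) fst snd"
proof -
  have "sum_rate_SC p \<sigma> = mutual_info (level_pmf p) (\<lambda>x. \<sigma> (fst x)) snd"
    by (simp add: sum_rate_SC_def joint_pmf_eq_level_pmf[OF assms] mutual_info_map_pmf
        X1_def X2_def Y_def case_prod_unfold)
  then show ?thesis
    by (simp add: mutual_info_inj bij_is_inj[OF assms])
qed

lemma cond_mutual_info_X1:
  "cond_mutual_info (joint_pmf p \<sigma>) X1 Y X2 = sum_rate_SC p \<sigma> - mutual_info (joint_pmf p \<sigma>) X2 Y"
  by (simp add: cond_mutual_info_chain sum_rate_SC_def)

lemma cond_mutual_info_X2:
  "cond_mutual_info (joint_pmf p \<sigma>) X2 Y X1 = sum_rate_SC p \<sigma> - mutual_info (joint_pmf p \<sigma>) X1 Y"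
  \<comment> \<open>The chain rule produces the pair in the order \<open>(X2, X1)\<close>, whereas
    the sum rate uses \<open>(X1, X2)\<close>.\<close>
  using mutual_info_inj[of prod.swap "joint_pmf p \<sigma>" "\<lambda>\<omega>. (X1 \<omega>, X2 \<omega>)" Y]
  by (simp add: cond_mutual_info_chain sum_rate_SC_def)

lemma pmf_color:
  fixes m :: "level_output \<Rightarrow> 'b"
  assumes "a \<in> {0..1}" "b \<in> {0..1}" "c \<in> {0..1}"
  shows "pmf (map_pmf (\<lambda>x. (B (fst x), m (snd x))) (level_pmf (p_MLC_E a b c))) (k, z) =
    (\<Sum>v\<in>UNIV. \<Sum>y\<in>UNIV. if B v = k \<and> m y = z then p_MLC_E a b c v y / 4 else 0)"
proof -
  have "pmf (map_pmf (\<lambda>x. (B (fst x), m (snd x))) (level_pmf (p_MLC_E a b c))) (k, z) =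
      (\<Sum>x\<in>{x. B (fst x) = k \<and> m (snd x) = z}. pmf (level_pmf (p_MLC_E a b c)) x)"
    by (simp add: pmf_map measure_measure_pmf_finite vimage_def)
  also have "\<dots> = (\<Sum>x\<in>UNIV. if B (fst x) = k \<and> m (snd x) = z
      then pmf (level_pmf (p_MLC_E a b c)) x else 0)"
    by (simp add: sum.If_cases)
  also have "\<dots> = (\<Sum>(v, y)\<in>UNIV \<times> UNIV. if B v = k \<and> m y = z then p_MLC_E a b c v y / 4 else 0)"
    by (rule sum.cong) (auto simp: pmf_level_pmf pmf_embed_p_MLC_E[OF assms])
  finally show ?thesis
    by (simp add: sum.cartesian_product)
qed

text \<open>With two levels of each colour, the colour of a uniform level is a fair bit, so the
  equivocation formula applies.\<close>

lemma color_info_eq: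
  fixes m :: "level_output \<Rightarrow> 'b::finite"
  assumes "a \<in> {0..1}" "b \<in> {0..1}" "c \<in> {0..1}" "card {v. B v} = 2"
  defines "r \<equiv> (\<lambda>k z. \<Sum>v\<in>UNIV. \<Sum>y\<in>UNIV. if B v = k \<and> m y = z then p_MLC_E a b c v y / 4 else 0)"
  shows "color_info (p_MLC_E a b c) m B = 1 - (\<Sum>z\<in>UNIV. split_ent (r True z) (r False z))"
proof -
  have 4: "card (UNIV :: level set) = 4"
    by (simp add: UNIV_level)
  have "card {v. \<not> B v} = 2"
    using assms(4) by (simp add: Collect_neg_eq Compl_eq_Diff_UNIV card_Diff_subset 4)
  then have "pmf (map_pmf B (pmf_of_set UNIV)) k = pmf (pmf_of_set UNIV) k" for k
    using assms(4) by (cases k) (simp_all add: pmf_map measure_pmf_of_set vimage_def 4)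
  then have "map_pmf B (map_pmf fst (level_pmf (p_MLC_E a b c))) = pmf_of_set UNIV"
    by (simp add: map_fst_level_pmf pmf_eqI)
  then have "map_pmf (\<lambda>x. B (fst x)) (level_pmf (p_MLC_E a b c)) = pmf_of_set UNIV"
    by (simp add: pmf.map_comp o_def)
  from mutual_info_uniform_bool[OF this, of "\<lambda>x. m (snd x)"] show ?thesis
    by (simp only: color_info_def pmf_color[OF assms(1-3)] r_def)
qed

section \<open>Information carried by the three colourings\<close>

abbreviation "info_01 p \<equiv> color_info p (\<lambda>y. y) (\<lambda>v. v = A0 \<or> v = A1)"
abbreviation "info_02 p \<equiv> color_info p (\<lambda>y. y) (\<lambda>v. v = A0 \<or> v = A2)"
abbreviation "info_03 p \<equiv> color_info p (\<lambda>y. y) (\<lambda>v. v = A0 \<or> v = A3)"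
abbreviation "info_01_merged p \<equiv> color_info p merge1 (\<lambda>v. v = A0 \<or> v = A1)"
abbreviation "info_03_merged p \<equiv> color_info p merge2 (\<lambda>v. v = A0 \<or> v = A3)"
abbreviation "info_level p \<equiv> mutual_info (level_pmf p) fst snd"

text \<open>\<open>S0\<close> comes from \<open>A0\<close> only, and \<open>S1\<close>,
  \<open>S2\<close>, \<open>S3\<close> come from two adjacent levels each; a
  \<open>split_ent\<close> term survives exactly where these levels differ in colour. Under
  \<open>merge1\<close> the levels \<open>A2\<close>, \<open>A3\<close> together put mass 1/2 on
  \<open>S2u3\<close>; under \<open>merge2\<close> the levels \<open>A1\<close>, \<open>A2\<close>
  put \<open>(1 + c) / 4\<close> on \<open>T1u2\<close>.\<close>

lemma color_info_values:
  assumes "0 < a" "a < 1" and "0 < b" "b < 1" and "0 < c" "c < 1"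
  defines "p \<equiv> p_MLC_E a b c"
  shows "info_01 p = 1 - split_ent ((1 - b) / 4) (c / 4)"
    and "info_03 p =
        1 - (split_ent ((1 - a) / 4) (b / 4) + split_ent ((1 - c) / 4) (1 / 4))"
    and "info_02 p =
        1 - (split_ent ((1 - a) / 4) (b / 4) + split_ent ((1 - b) / 4) (c / 4)
          + split_ent ((1 - c) / 4) (1 / 4))"
    and "info_01_merged p = 1 - split_ent ((1 - b) / 4) (1 / 2)"
    and "info_03_merged p =
        1 - (split_ent ((1 - a) / 4) ((1 + c) / 4) + split_ent ((1 - c) / 4) (1 / 4))"
proof -
  have *: "{v. v = A0 \<or> v = u} = {A0, u}" for u
    by auto
  \<comment> \<open>As an ordered rewrite rule, \<open>split_ent_commute\<close> aligns the
    arguments on both sides, whichever colour is \<open>True\<close>.\<close>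
  note simps = * p_def UNIV_level UNIV_level_output UNIV_merged_output1 UNIV_merged_output2
    split_ent_commute
  show "info_01 p = 1 - split_ent ((1 - b) / 4) (c / 4)"
    using assms(1-6) unfolding p_def by (subst color_info_eq) (simp_all add: simps)
  show "info_03 p =
        1 - (split_ent ((1 - a) / 4) (b / 4) + split_ent ((1 - c) / 4) (1 / 4))"
    using assms(1-6) unfolding p_def by (subst color_info_eq) (simp_all add: simps)
  show "info_02 p =
        1 - (split_ent ((1 - a) / 4) (b / 4) + split_ent ((1 - b) / 4) (c / 4)
          + split_ent ((1 - c) / 4) (1 / 4))"
    using assms(1-6) unfolding p_def by (subst color_info_eq) (simp_all add: simps)
  show "info_01_merged p = 1 - split_ent ((1 - b) / 4) (1 / 2)"
    using assms(1-6) unfolding p_def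
    by (subst color_info_eq) (simp_all add: simps add_divide_distrib[symmetric])
  show "info_03_merged p =
        1 - (split_ent ((1 - a) / 4) ((1 + c) / 4) + split_ent ((1 - c) / 4) (1 / 4))"
    using assms(1-6) unfolding p_def
    by (subst color_info_eq) (simp_all add: simps add_divide_distrib[symmetric])
qed

text \<open>\<open>info_02\<close> subtracts all three positive terms, and each of the others omits
  at least one. Merging raises one argument of \<open>split_ent\<close>, from \<open>c / 4\<close>
  to \<open>1 / 2\<close> or from \<open>b / 4\<close> to \<open>(1 + c) / 4\<close>.\<close>

lemma color_info_less:
  assumes "0 < a" "a < 1" and "0 < b" "b < 1" and "0 < c" "c < 1"
  defines "p \<equiv> p_MLC_E a b c"
  shows "info_02 p < info_01 p" "info_02 p < info_03 p"
    and "info_01_merged p < info_01 p" "info_03_merged p < info_03 p"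
  unfolding p_def color_info_values[OF assms(1-6)]
  using assms(1-6) split_ent_pos[of "(1 - a) / 4" "b / 4"] split_ent_pos[of "(1 - b) / 4" "c / 4"]
    split_ent_pos[of "(1 - c) / 4" "1 / 4"] split_ent_strict_mono[of "(1 - b) / 4" "c / 4" "1 / 2"]
    split_ent_strict_mono[of "(1 - a) / 4" "b / 4" "(1 + c) / 4"]
  by simp_all

section \<open>From colourings back to labelings, regions and sum rates\<close>

lemma color_info_nonneg: "0 \<le> color_info p m B"
  unfolding color_info_def by (rule mutual_info_nonneg)

text \<open>All three labelings send \<open>A0\<close> to 11, so each bit is determined by the one
  other level at which it equals 1.\<close>

lemma labeling_colors:
  "fst (labeling_G v) \<longleftrightarrow> v = A0 \<or> v = A1" "snd (labeling_G v) \<longleftrightarrow> v = A0 \<or> v = A3"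
  "fst (labeling_NO v) \<longleftrightarrow> v = A0 \<or> v = A1" "snd (labeling_NO v) \<longleftrightarrow> v = A0 \<or> v = A2"
  "fst (labeling_EO v) \<longleftrightarrow> v = A0 \<or> v = A3" "snd (labeling_EO v) \<longleftrightarrow> v = A0 \<or> v = A2"
  by (cases v; simp)+

lemma labeling_mutual_info:
  "mutual_info (joint_pmf p labeling_G) X1 Y = info_01 p"
  "mutual_info (joint_pmf p labeling_G) X2 Y = info_03 p"
  "mutual_info (joint_pmf p labeling_G) X1 Y1 = info_01_merged p"
  "mutual_info (joint_pmf p labeling_G) X2 Y2 = info_03_merged p"
  "mutual_info (joint_pmf p labeling_NO) X1 Y = info_01 p"
  "mutual_info (joint_pmf p labeling_NO) X2 Y = info_02 p"
  "mutual_info (joint_pmf p labeling_EO) X1 Y = info_03 p"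
  "mutual_info (joint_pmf p labeling_EO) X2 Y = info_02 p"
  by (simp_all add: mutual_info_joint_pmf bij_labeling_G bij_labeling_NO bij_labeling_EO
      labeling_colors)

lemma labeling_sum_rate_SC:
  "sum_rate_SC p labeling_G = info_level p"
  "sum_rate_SC p labeling_NO = info_level p"
  "sum_rate_SC p labeling_EO = info_level p"
  by (simp_all add: sum_rate_SC_eq bij_labeling_G bij_labeling_NO bij_labeling_EO)

lemma labeling_region_TIN:
  "region_TIN p labeling_G = {0..info_01 p} \<times> {0..info_03 p}"
  "region_TIN p labeling_NO = {0..info_01 p} \<times> {0..info_02 p}"
  by (auto simp: region_TIN_def labeling_mutual_info)

lemma labeling_region_DS:
  "region_DS p labeling_G = {0..info_01_merged p} \<times> {0..info_03_merged p}"
  by (auto simp: region_DS_def labeling_mutual_info)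

text \<open>By the chain rule each rate bound subtracts the information of the other bit. G and NO
  share the first bit, so their regions differ only in the bound on \<open>R1\<close>.\<close>

lemma labeling_region_SC:
  "region_SC p labeling_G = {(R1, R2). 0 \<le> R1 \<and> 0 \<le> R2 \<and> R1 \<le> info_level p - info_03 p \<and>
    R2 \<le> info_level p - info_01 p \<and> R1 + R2 \<le> info_level p}"
  "region_SC p labeling_NO = {(R1, R2). 0 \<le> R1 \<and> 0 \<le> R2 \<and> R1 \<le> info_level p - info_02 p \<and>
    R2 \<le> info_level p - info_01 p \<and> R1 + R2 \<le> info_level p}"
  by (simp_all add: region_SC_def cond_mutual_info_X1 cond_mutual_info_X2 labeling_mutual_info
      labeling_sum_rate_SC flip: sum_rate_SC_def)

text \<open>The chain rule writes each difference as a conditional mutual information, which is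
  nonnegative. NO serves here because its two bits are exactly these colourings.\<close>

lemma color_info_le_info_level:
  "info_01 p \<le> info_level p" "info_02 p \<le> info_level p"
  using cond_mutual_info_nonneg[of "joint_pmf p labeling_NO" X2 Y X1]
    cond_mutual_info_nonneg[of "joint_pmf p labeling_NO" X1 Y X2]
  by (simp_all add: cond_mutual_info_X1 cond_mutual_info_X2 labeling_mutual_info
      labeling_sum_rate_SC)

section \<open>Strict inclusions\<close>

lemma rectangle_psubset:
  fixes x y x' y' :: real
  assumes "x \<le> x'" "y \<le> y'" "x < x' \<or> y < y'" "0 \<le> x'" "0 \<le> y'"
  shows "{0..x} \<times> {0..y} \<subset> {0..x'} \<times> {0..y'}"
proof (rule psubsetI)
  \<comment> \<open>The upper corner of the larger rectangle separates the two.\<close>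
  have "(x', y') \<in> {0..x'} \<times> {0..y'}" "(x', y') \<notin> {0..x} \<times> {0..y}"
    using assms by auto
  then show "{0..x} \<times> {0..y} \<noteq> {0..x'} \<times> {0..y'}"
    by blast
qed (use assms in auto)

theorem theorem5:
  fixes a1 b1 c1 :: real
  assumes "0 < a1" "a1 < 1" and "0 < b1" "b1 < 1" and "0 < c1" "c1 < 1"
  shows
    "region_DS (p_MLC_E a1 b1 c1) labeling_G \<subset> region_TIN (p_MLC_E a1 b1 c1) labeling_G \<and>
     region_TIN (p_MLC_E a1 b1 c1) labeling_NO \<subset> region_TIN (p_MLC_E a1 b1 c1) labeling_G \<and>
     region_SC (p_MLC_E a1 b1 c1) labeling_G \<subset> region_SC (p_MLC_E a1 b1 c1) labeling_NO \<and>
     sum_rate_TIN (p_MLC_E a1 b1 c1) labeling_G > sum_rate_DS (p_MLC_E a1 b1 c1) labeling_G \<and>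
     sum_rate_TIN (p_MLC_E a1 b1 c1) labeling_G > sum_rate_TIN (p_MLC_E a1 b1 c1) labeling_NO \<and>
     sum_rate_TIN (p_MLC_E a1 b1 c1) labeling_G > sum_rate_TIN (p_MLC_E a1 b1 c1) labeling_EO \<and>
     sum_rate_SC (p_MLC_E a1 b1 c1) labeling_G = sum_rate_SC (p_MLC_E a1 b1 c1) labeling_NO \<and>
     sum_rate_SC (p_MLC_E a1 b1 c1) labeling_NO = sum_rate_SC (p_MLC_E a1 b1 c1) labeling_EO"
proof -
  let ?p = "p_MLC_E a1 b1 c1"
  note less = color_info_less[OF assms]
  have "region_DS ?p labeling_G \<subset> region_TIN ?p labeling_G"
    "region_TIN ?p labeling_NO \<subset> region_TIN ?p labeling_G"
    using less unfolding labeling_region_TIN labeling_region_DS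
    by (simp_all add: rectangle_psubset color_info_nonneg)
  moreover have "region_SC ?p labeling_G \<subset> region_SC ?p labeling_NO"
  proof (rule psubsetI)
    \<comment> \<open>The point takes the largest \<open>R1\<close> allowed under NO. It violates
      the bound on \<open>R1\<close> under G since \<open>info_02\<close> is below
      \<open>info_03\<close>, and it meets the sum constraint since \<open>info_02\<close> is
      nonnegative.\<close>
    have "(info_level ?p - info_02 ?p, 0) \<in> region_SC ?p labeling_NO - region_SC ?p labeling_G"
      using less color_info_nonneg color_info_le_info_level[of ?p] by (simp add: labeling_region_SC)
    then show "region_SC ?p labeling_G \<noteq> region_SC ?p labeling_NO"
      by blast
  qed (use less in \<open>auto simp: labeling_region_SC\<close>)
  ultimately show ?thesis
    using less
    by (simp add: sum_rate_TIN_def sum_rate_DS_def labeling_mutual_info labeling_sum_rate_SC)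
qed

end
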